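(* The principal generators $S_{kl}^{(m)}$ of the Yangian $Y(\mathfrak{gl}(n))$ satisfy the following relations, for $i,j,k,l\in\mathbb Z/n\mathbb Z$: $$[S_{ij}(u),S_{kl}(v)]=\frac{1}{u-v}\left(\sum_{a,b}\frac{\omega^{ib-bk-ab}}{n}\,S_{k+a,l+b}(u)\,S_{i-a,j-b}(v)-\sum_{a,b}\frac{\omega^{ja-al+ab}}{n}\,S_{k+a,l+b}(v)\,S_{i-a,j-b}(u)\right),$$ where $a,b$ run over $\mathbb Z/n\mathbb Z$.
   Context: Let $\omega=e^{2\pi i/n}$ (here $i=\sqrt{-1}$; elsewhere $i$ is an index). $E_{ij}$ denotes the $n\times n$ matrix units acting on $V=\mathbb C^n$, with indices read in $\mathbb Z/n\mathbb Z$. For $k,l\in\mathbb Z/n\mathbb Z$ the principal basis element is $A_{kl}=\sum_{p\in\mathbb Z/n\mathbb Z}\omega^{kp}E_{p,p+l}$; the $A_{kl}$ form a basis of $\mathrm{End}(V)$. The Yangian $Y(\mathfrak{gl}(n))$ is the complex associative unital algebra generated by $T_{ij}^{(m)}$ ($1\le i,j\le n$, $m=1,2,\dots$) subject to $$[T_{ij}^{(l+1)},T_{i'j'}^{(m)}]-[T_{ij}^{(l)},T_{i'j'}^{(m+1)}]=T_{i'j}^{(l)}T_{ij'}^{(m)}-T_{i'j}^{(m)}T_{ij'}^{(l)},\qquad l,m=0,1,2,\dots,$$ where $T_{ij}^{(0)}=\delta_{ij}\cdot 1$. Put $T_{ij}(u)=\delta_{ij}+\sum_{m\ge1}T_{ij}^{(m)}u^{-m}$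 and $T(u)=\sum_{i,j}T_{ij}(u)\otimes E_{ij}$, with coefficients in $Y(\mathfrak{gl}(n))\otimes\mathrm{End}(V)$. The principal generators $S_{kl}^{(m)}$ are the coefficients of the series $S_{kl}(u)=\sum_{m\ge0}S_{kl}^{(m)}u^{-m}$, $S_{kl}^{(0)}=\delta_{k0}\delta_{l0}\cdot1$, determined by writing $$T(u)=\sum_{k,l\in\mathbb Z/n\mathbb Z}S_{kl}(u)\otimes A_{kl}.$$ Here $u,v$ are formal variables.
   Formalization: The printed formula fails for n = 2 (it would make all S_{kl}^{(1)} commute); proved instead with first-sum factors S_{i-a,j-b}(u) S_{k+a,l+b}(v) (index pairs exchanged) and second-sum exponent ja-al-ab in place of ja-al+ab. *)

theory Defs
  imports
    "Berlekamp_Zassenhaus.Finite_Field"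
    "HOL-Analysis.Analysis"
    "HOL-Library.Poly_Mapping"
    "HOL-Computational_Algebra.Formal_Laurent_Series"
begin

no_notation fps_nth (infixl \<open>$\<close> 75)

definition commutator :: "'a::ring \<Rightarrow> 'a \<Rightarrow> 'a" where
  "commutator x y = x * y - y * x"

section \<open>Free associative algebras\<close>

text \<open>The free monoid is written additively, because \<open>\<Rightarrow>\<^sub>0\<close> takes its convolution product from \<open>+\<close> on
  the type of exponents.\<close>

datatype 'g free_monoid = Word "'g list"

instantiation free_monoid :: (type) monoid_add
begin

definition zero_free_monoid :: "'g free_monoid" where
  "zero_free_monoid = Word []"

fun plus_free_monoid :: "'g free_monoid \<Rightarrow> 'g free_monoid \<Rightarrow> 'g free_monoid" where
  "plus_free_monoid (Word xs) (Word ys) = Word (xs @ ys)"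

instance
proof
  fix a b c :: "'g free_monoid"
  show "a + b + c = a + (b + c)"
    by (cases a; cases b; cases c) simp
  show "0 + a = a" "a + 0 = a"
    by (cases a; simp add: zero_free_monoid_def)+
qed

end

type_synonym 'g free_algebra = "'g free_monoid \<Rightarrow>\<^sub>0 complex"

inductive_set two_sided_ideal :: "'a::ring_1 set \<Rightarrow> 'a set" for R where
  zero: "0 \<in> two_sided_ideal R"
| base: "x \<in> R \<Longrightarrow> x \<in> two_sided_ideal R"
| add: "x \<in> two_sided_ideal R \<Longrightarrow> y \<in> two_sided_ideal R \<Longrightarrow> x + y \<in> two_sided_ideal R"
| left: "x \<in> two_sided_ideal R \<Longrightarrow> c * x \<in> two_sided_ideal R"
| right: "x \<in> two_sided_ideal R \<Longrightarrow> x * c \<in> two_sided_ideal R"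

lemma two_sided_ideal_uminus:
  "x \<in> two_sided_ideal R \<Longrightarrow> - x \<in> two_sided_ideal R"
  using two_sided_ideal.left[of x R "- 1"] by simp

section \<open>The Yangian of \<open>gl(n)\<close>\<close>

text \<open>Throughout, \<open>n = CARD('n)\<close>, and \<open>'n mod_ring\<close> is the ring of integers modulo \<open>n\<close>.
  The symbol \<open>(i, j, r)\<close> is the generator \<open>T\<^sub>i\<^sub>j\<close> of level \<open>r + 1\<close>.\<close>

type_synonym 'n yangian_symbol = "'n mod_ring \<times> 'n mod_ring \<times> nat"

definition free_T :: "'n::finite mod_ring \<Rightarrow> 'n mod_ring \<Rightarrow> nat \<Rightarrow> 'n yangian_symbol free_algebra" where
  "free_T i j m = (case m of 0 \<Rightarrow> (if i = j then 1 else 0)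
                   | Suc r \<Rightarrow> Poly_Mapping.single (Word [(i, j, r)]) 1)"

definition yangian_relators :: "'n::finite yangian_symbol free_algebra set" where
  "yangian_relators = {commutator (free_T i j (l + 1)) (free_T i' j' m)
       - commutator (free_T i j l) (free_T i' j' (m + 1))
       - (free_T i' j l * free_T i j' m - free_T i' j m * free_T i j' l)
     | i j i' j' l m. True}"

definition yangian_rel :: "'n::finite yangian_symbol free_algebra \<Rightarrow> 'n yangian_symbol free_algebra \<Rightarrow> bool" where
  "yangian_rel x y \<longleftrightarrow> x - y \<in> two_sided_ideal yangian_relators"

quotient_type (overloaded) 'n yangian = "'n::finite yangian_symbol free_algebra" / yangian_rel
proof (rule equivpI)
  show "reflp (yangian_rel :: 'n yangian_symbol free_algebra \<Rightarrow> _)"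
    by (auto simp: reflp_def yangian_rel_def two_sided_ideal.zero)
  show "symp (yangian_rel :: 'n yangian_symbol free_algebra \<Rightarrow> _)"
  proof (rule sympI)
    fix x y :: "'n yangian_symbol free_algebra"
    assume "yangian_rel x y"
    then show "yangian_rel y x"
      using two_sided_ideal_uminus[of "x - y"] by (simp add: yangian_rel_def)
  qed
  show "transp (yangian_rel :: 'n yangian_symbol free_algebra \<Rightarrow> _)"
  proof (rule transpI)
    fix x y z :: "'n yangian_symbol free_algebra"
    assume "yangian_rel x y" "yangian_rel y z"
    then show "yangian_rel x z"
      using two_sided_ideal.add[of "x - y" _ "y - z"] by (simp add: yangian_rel_def)
  qed
qed

text \<open>The augmentation, i.e. the coefficient of the empty word, kills the relators. Hence the Yangian is
  not the zero ring.\<close>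

lemma free_monoid_add_eq_0_iff: "a + b = (0 :: 'g free_monoid) \<longleftrightarrow> a = 0 \<and> b = 0"
  by (cases a; cases b) (auto simp: zero_free_monoid_def)

lemma lookup_mult_0:
  fixes f g :: "'g free_algebra"
  shows "Poly_Mapping.lookup (f * g) 0 = Poly_Mapping.lookup f 0 * Poly_Mapping.lookup g 0"
proof -
  have inner: "Sum_any (\<lambda>q. Poly_Mapping.lookup g q when 0 = l + q) = (Poly_Mapping.lookup g 0 when l = 0)" for l
  proof (cases "l = 0")
    case True
    have "(\<lambda>q. Poly_Mapping.lookup g q when 0 = l + q) = (\<lambda>q. Poly_Mapping.lookup g q when q = 0)"
      using True by (auto simp: when_def)
    then show ?thesis using True by simp
  next
    case False
    have "(\<lambda>q. Poly_Mapping.lookup g q when 0 = l + q) = (\<lambda>q. 0)"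
      using False free_monoid_add_eq_0_iff[of l] by (intro ext) (metis when_def)
    then show ?thesis using False by (simp only: Sum_any.neutral when_simps)
  qed
  have "Poly_Mapping.lookup (f * g) 0 = Sum_any (\<lambda>l. Poly_Mapping.lookup f l * (Poly_Mapping.lookup g 0 when l = 0))"
    by (simp only: lookup_mult inner)
  also have "(\<lambda>l. Poly_Mapping.lookup f l * (Poly_Mapping.lookup g 0 when l = 0)) =
      (\<lambda>l. Poly_Mapping.lookup f l * Poly_Mapping.lookup g 0 when l = 0)"
    by (auto simp: when_def)
  finally show ?thesis by simp
qed

lemma lookup_free_T_0:
  "Poly_Mapping.lookup (free_T i j m) 0 = (if m = 0 \<and> i = j then 1 else 0)"
proof -
  have "Word xs = 0 \<longleftrightarrow> xs = []" for xs :: "'a yangian_symbol list"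
    by (simp add: zero_free_monoid_def)
  then show ?thesis
    by (auto simp: free_T_def lookup_single when_def split: nat.splits)
qed

lemma lookup_yangian_ideal_0:
  "x \<in> two_sided_ideal (yangian_relators :: 'n::finite yangian_symbol free_algebra set) \<Longrightarrow>
     Poly_Mapping.lookup x 0 = 0"
proof (induction rule: two_sided_ideal.induct)
  case (base x)
  then show ?case
    by (auto simp: yangian_relators_def commutator_def lookup_minus lookup_mult_0 lookup_free_T_0)
qed (auto simp: lookup_add lookup_mult_0)

instantiation yangian :: (finite) ring_1
begin

lift_definition zero_yangian :: "'a yangian" is 0 .

lift_definition one_yangian :: "'a yangian" is 1 .

lift_definition plus_yangian :: "'a yangian \<Rightarrow> 'a yangian \<Rightarrow> 'a yangian" is "(+)"
proof -
  fix a b c d :: "'a yangian_symbol free_algebra"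
  assume "yangian_rel a b" "yangian_rel c d"
  then have "(a - b) + (c - d) \<in> two_sided_ideal yangian_relators"
    unfolding yangian_rel_def by (intro two_sided_ideal.add)
  then show "yangian_rel (a + c) (b + d)"
    unfolding yangian_rel_def by (simp add: add_diff_add)
qed

lift_definition uminus_yangian :: "'a yangian \<Rightarrow> 'a yangian" is uminus
proof -
  fix a b :: "'a yangian_symbol free_algebra"
  assume "yangian_rel a b"
  then have "- (a - b) \<in> two_sided_ideal yangian_relators"
    unfolding yangian_rel_def by (rule two_sided_ideal_uminus)
  then show "yangian_rel (- a) (- b)"
    unfolding yangian_rel_def by simp
qed

lift_definition minus_yangian :: "'a yangian \<Rightarrow> 'a yangian \<Rightarrow> 'a yangian" is "(-)"
proof -
  fix a b c d :: "'a yangian_symbol free_algebra"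
  assume "yangian_rel a b" "yangian_rel c d"
  then have "(a - b) + - (c - d) \<in> two_sided_ideal yangian_relators"
    unfolding yangian_rel_def by (intro two_sided_ideal.add two_sided_ideal_uminus)
  then show "yangian_rel (a - c) (b - d)"
    unfolding yangian_rel_def by (simp add: algebra_simps)
qed

lift_definition times_yangian :: "'a yangian \<Rightarrow> 'a yangian \<Rightarrow> 'a yangian" is "(*)"
proof -
  fix a b c d :: "'a yangian_symbol free_algebra"
  assume "yangian_rel a b" "yangian_rel c d"
  then have "(a - b) * c + b * (c - d) \<in> two_sided_ideal yangian_relators"
    unfolding yangian_rel_def
    by (intro two_sided_ideal.add two_sided_ideal.left two_sided_ideal.right)
  then show "yangian_rel (a * c) (b * d)"
    unfolding yangian_rel_def by (simp add: algebra_simps)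
qed

instance
proof
  fix a b c :: "'a yangian"
  have eq: "yangian_rel x y" if "x = y" for x y :: "'a yangian_symbol free_algebra"
    using that by (simp add: yangian_rel_def two_sided_ideal.zero)
  show "a * b * c = a * (b * c)" by transfer (rule eq, simp add: mult.assoc)
  show "1 * a = a" by transfer (rule eq, simp)
  show "a * 1 = a" by transfer (rule eq, simp)
  show "a + b + c = a + (b + c)" by transfer (rule eq, simp add: add.assoc)
  show "a + b = b + a" by transfer (rule eq, simp add: add.commute)
  show "0 + a = a" by transfer (rule eq, simp)
  show "- a + a = 0" by transfer (rule eq, simp)
  show "a - b = a + - b" by transfer (rule eq, simp)
  show "(a + b) * c = a * c + b * c" by transfer (rule eq, simp add: distrib_right)
  show "a * (b + c) = a * b + a * c" by transfer (rule eq, simp add: distrib_left)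
  show "(0 :: 'a yangian) \<noteq> 1"
  proof transfer
    show "\<not> yangian_rel 0 (1 :: 'a yangian_symbol free_algebra)"
      using lookup_yangian_ideal_0[of "- 1 :: 'a yangian_symbol free_algebra"]
      by (auto simp: yangian_rel_def)
  qed
qed

end

lift_definition yangian_T :: "'n::finite mod_ring \<Rightarrow> 'n mod_ring \<Rightarrow> nat \<Rightarrow> 'n yangian" is free_T .

text \<open>The structure map of the complex algebra, \<open>c \<mapsto> c \<cdot> 1\<close>.\<close>

lift_definition yangian_of_complex :: "complex \<Rightarrow> 'n::finite yangian" is
  "\<lambda>c. Poly_Mapping.single 0 c" .

lemma yangian_rel_refl: "yangian_rel x x"
  by (simp add: yangian_rel_def two_sided_ideal.zero)

lemma yangian_T_0: "yangian_T i j 0 = (if i = j then 1 else 0)"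
  by transfer (simp add: free_T_def yangian_rel_refl)

lemma yangian_T_relation:
  "commutator (yangian_T i j (l + 1)) (yangian_T i' j' m)
     - commutator (yangian_T i j l) (yangian_T i' j' (m + 1))
   = yangian_T i' j l * yangian_T i j' m - yangian_T i' j m * yangian_T i j' l"
  unfolding commutator_def
proof transfer
  fix i j i' j' :: "'a mod_ring" and l m
  show "yangian_rel
     (free_T i j (l + 1) * free_T i' j' m - free_T i' j' m * free_T i j (l + 1)
       - (free_T i j l * free_T i' j' (m + 1) - free_T i' j' (m + 1) * free_T i j l))
     (free_T i' j l * free_T i j' m - free_T i' j m * free_T i j' l)"
    unfolding yangian_rel_def yangian_relators_def commutator_def
    by (rule two_sided_ideal.base) blast
qed

lemma yangian_of_complex_0 [simp]: "yangian_of_complex 0 = 0"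
  by transfer (simp add: yangian_rel_refl)

lemma yangian_of_complex_1 [simp]: "yangian_of_complex 1 = 1"
  by transfer (simp add: yangian_rel_refl)

lemma yangian_of_complex_add:
  "yangian_of_complex (a + b) = yangian_of_complex a + yangian_of_complex b"
  by transfer (simp add: yangian_rel_refl single_add)

lemma yangian_of_complex_mult:
  "yangian_of_complex (a * b) = yangian_of_complex a * yangian_of_complex b"
  by transfer (simp add: yangian_rel_refl mult_single)

lemma yangian_of_complex_sum:
  "yangian_of_complex (sum f A) = (\<Sum>x\<in>A. yangian_of_complex (f x))"
  by (induction A rule: infinite_finite_induct) (simp_all add: yangian_of_complex_add)

section \<open>Principal generators\<close>

text \<open>\<open>root_pow x\<close> is \<open>\<omega>\<^sup>x\<close> for \<open>\<omega> = exp (2 \<pi> \<i> / n)\<close> and \<open>x\<close> modulo \<open>n\<close>.\<close>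

definition root_pow :: "'n::finite mod_ring \<Rightarrow> complex" where
  "root_pow x = exp (2 * of_real pi * \<i> / of_nat CARD('n)) powi to_int_mod_ring x"

definition matrix_unit :: "'m::finite \<Rightarrow> 'm \<Rightarrow> complex^'m^'m" where
  "matrix_unit i j = (\<chi> r s. if r = i \<and> s = j then 1 else 0)"

definition principal_basis :: "'n::finite mod_ring \<Rightarrow> 'n mod_ring \<Rightarrow> complex^'n mod_ring^'n mod_ring" where
  "principal_basis k l = (\<Sum>p\<in>UNIV. mat (root_pow (k * p)) ** matrix_unit p (p + l))"

text \<open>Power series over the Yangian are series in \<open>u\<^sup>-\<^sup>1\<close>, that is, \<^const>\<open>fps_X\<close> stands for \<open>u\<^sup>-\<^sup>1\<close>. The
  algebra \<open>Y \<otimes> End(V)\<close> is the algebra of matrices over \<open>Y\<close>, in which \<open>y \<otimes> M\<close> has the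
  entries \<open>M\<^sub>r\<^sub>s y\<close>.\<close>

definition series_tensor ::
    "'n::finite yangian fps \<Rightarrow> complex^'m^'m \<Rightarrow> 'n yangian fps^'m^'m" where
  "series_tensor f M = (\<chi> r s. fps_const (yangian_of_complex (M $ r $ s)) * f)"

definition T_series :: "'n::finite mod_ring \<Rightarrow> 'n mod_ring \<Rightarrow> 'n yangian fps" where
  "T_series i j = Abs_fps (yangian_T i j)"

definition T_matrix :: "'n::finite yangian fps^'n mod_ring^'n mod_ring" where
  "T_matrix = (\<Sum>i\<in>UNIV. \<Sum>j\<in>UNIV. series_tensor (T_series i j) (matrix_unit i j))"

definition S_series :: "'n::finite mod_ring \<Rightarrow> 'n mod_ring \<Rightarrow> 'n yangian fps" where
  "S_series = (THE S. T_matrix = (\<Sum>k\<in>UNIV. \<Sum>l\<in>UNIV. series_tensor (S k l) (principal_basis k l)))"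

lemma root_pow_eq: "root_pow (x :: 'n::finite mod_ring) = cis (2 * pi * to_int_mod_ring x / CARD('n))"
proof -
  have "exp (2 * of_real pi * \<i> / of_nat CARD('n)) = cis (2 * pi / CARD('n))"
    by (simp add: cis_conv_exp mult_ac)
  then show ?thesis
    by (simp add: root_pow_def cis_power_int mult_ac)
qed

lemma cis_mod: "cis (2 * pi * of_int (m mod int n) / of_nat n) = cis (2 * pi * of_int m / of_nat n)"
  if "n > 0" for n :: nat and m :: int
proof -
  have "of_int m = of_nat n * of_int (m div int n) + (of_int (m mod int n) :: real)"
    by (metis mult_div_mod_eq of_int_add of_int_mult of_int_of_nat_eq)
  then have "2 * pi * of_int m / of_nat n
      = 2 * pi * of_int (m mod int n) / of_nat n + 2 * pi * of_int (m div int n)"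
    using that by (simp add: field_simps)
  then show ?thesis
    by (simp add: cis_mult[symmetric] cis_multiple_2pi)
qed

lemma to_int_mod_ring_add:
  "to_int_mod_ring (x + y :: 'n::finite mod_ring) = (to_int_mod_ring x + to_int_mod_ring y) mod int CARD('n)"
  by transfer simp

lemma root_pow_add: "root_pow (x + y :: 'n::finite mod_ring) = root_pow x * root_pow y"
proof -
  have "root_pow (x + y) = cis (2 * pi * of_int (to_int_mod_ring x + to_int_mod_ring y) / of_nat CARD('n))"
    unfolding root_pow_eq to_int_mod_ring_add by (rule cis_mod) simp
  then show ?thesis
    by (simp add: root_pow_eq cis_mult ring_distribs add_divide_distrib)
qed

lemma root_pow_0 [simp]: "root_pow 0 = 1"
  by (simp add: root_pow_def)

lemma root_pow_neq_1:
  assumes "x \<noteq> (0 :: 'n::finite mod_ring)"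
  shows "root_pow x \<noteq> 1"
proof
  assume "root_pow x = 1"
  define t where "t = to_int_mod_ring x"
  have "t \<in> range (to_int_mod_ring :: 'n mod_ring \<Rightarrow> int)" by (simp add: t_def)
  then have t: "0 \<le> t" "t < int CARD('n)" by (simp_all add: range_to_int_mod_ring)
  have "t \<noteq> 0"
    using assms unfolding t_def by (metis of_int_mod_ring_to_int_mod_ring to_int_mod_ring_hom.hom_zero)
  have "cos (2 * pi * t / CARD('n)) = 1"
    using \<open>root_pow x = 1\<close> by (simp add: root_pow_eq complex_eq_iff t_def)
  then obtain z :: int where "2 * pi * t / CARD('n) = z * (2 * pi)"
    by (auto simp: cos_one_2pi_int)
  then have "real_of_int t = of_int (z * int CARD('n))"
    by (simp add: field_simps)
  then have "t = z * int CARD('n)" by linarith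
  with t \<open>t \<noteq> 0\<close> show False
    by (metis dvd_triv_right zdvd_not_zless order_le_less)
qed

lemma sum_root_pow:
  "(\<Sum>k\<in>UNIV. root_pow (k * x)) = (if x = (0 :: 'n::finite mod_ring) then of_nat CARD('n) else 0)"
proof (cases "x = 0")
  case False
  have "CARD('n) > 1"
  proof (rule ccontr)
    assume "\<not> CARD('n) > 1"
    then have "CARD('n mod_ring) = 1" using zero_less_card_finite[where 'a='n] by (simp del: zero_less_card_finite)
    then show False using False by (metis UNIV_I card_1_singletonE singletonD)
  qed
  define e :: "'n mod_ring" where "e = of_int_mod_ring 1"
  have "e * x = x"
    unfolding e_def using \<open>CARD('n) > 1\<close> by transfer simp
  then have "root_pow (e * x) \<noteq> 1" using root_pow_neq_1[OF False] by simp
  have "(\<Sum>k\<in>UNIV. root_pow (k * x)) = (\<Sum>k\<in>UNIV. root_pow ((k + e) * x))"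
    by (rule sum.reindex_bij_witness[of _ "\<lambda>k. k + e" "\<lambda>k. k - e"]) simp_all
  also have "\<dots> = root_pow (e * x) * (\<Sum>k\<in>UNIV. root_pow (k * x))"
    by (simp add: ring_distribs root_pow_add sum_distrib_left mult.commute)
  finally have "(root_pow (e * x) - 1) * (\<Sum>k\<in>UNIV. root_pow (k * x)) = 0"
    by (simp add: ring_distribs)
  with \<open>root_pow (e * x) \<noteq> 1\<close> False show ?thesis by simp
qed simp

lemma principal_basis_nth:
  "principal_basis k l $ r $ s = (if s = r + l then root_pow (k * r) else 0)"
proof -
  have "(mat c ** matrix_unit p q) $ r $ s = (if r = p \<and> s = q then c else 0)"
    for c :: complex and p q r s :: "'a mod_ring"
  proof -
    have "(mat c ** matrix_unit p q) $ r $ s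
        = (\<Sum>x\<in>UNIV. if x = r then c * (if r = p \<and> s = q then 1 else 0) else 0)"
      unfolding matrix_matrix_mult_def mat_def matrix_unit_def vec_lambda_beta
      by (rule sum.cong) auto
    then show ?thesis by simp
  qed
  then have "principal_basis k l $ r $ s
      = (\<Sum>p\<in>UNIV. if r = p \<and> s = p + l then root_pow (k * p) else 0)"
    unfolding principal_basis_def by simp
  also have "\<dots> = (\<Sum>p\<in>UNIV. if r = p then (if s = r + l then root_pow (k * r) else 0) else 0)"
    by (intro sum.cong refl) auto
  finally show ?thesis by simp
qed

lemma series_tensor_nth:
  "M $ r $ s = (if P then c else 0) \<Longrightarrow>
     series_tensor f M $ r $ s = (if P then fps_const (yangian_of_complex c) * f else 0)"
  by (simp add: series_tensor_def)

lemma T_matrix_nth: "T_matrix $ r $ s = T_series r s"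
proof -
  have "matrix_unit i j $ r $ s = (if j = s \<and> i = r then 1 else 0)" for i j
    by (auto simp: matrix_unit_def)
  then have "series_tensor f (matrix_unit i j) $ r $ s = (if j = s \<and> i = r then f else 0)"
    for i j and f :: "'a yangian fps"
    by (subst series_tensor_nth) auto
  note [simp] = this
  have "T_matrix $ r $ s = (\<Sum>i\<in>UNIV. \<Sum>j\<in>UNIV. if j = s \<and> i = r then T_series i j else 0)"
    unfolding T_matrix_def by simp
  also have "\<dots> = (\<Sum>i\<in>UNIV. \<Sum>j\<in>UNIV. if j = s then (if i = r then T_series i j else 0) else 0)"
    by (intro sum.cong refl) auto
  finally show ?thesis by simp
qed

lemma principal_expansion_nth:
  "(\<Sum>k\<in>UNIV. \<Sum>l\<in>UNIV. series_tensor (S k l) (principal_basis k l)) $ r $ (r + l)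
     = (\<Sum>k\<in>UNIV. fps_const (yangian_of_complex (root_pow (k * r))) * S k l)"
proof -
  have "principal_basis k l' $ r $ (r + l) = (if l' = l then root_pow (k * r) else 0)" for k l'
    by (auto simp: principal_basis_nth)
  note [simp] = series_tensor_nth[OF this]
  show ?thesis by simp
qed

lemma fps_const_sum': "fps_const (sum f A) = (\<Sum>x\<in>A. fps_const (f x))"
  by (induction A rule: infinite_finite_induct) (simp_all flip: fps_const_add)

lemma inverse_transform:
  fixes f :: "'m::finite \<Rightarrow> 'n::finite yangian fps" and A :: "'m \<Rightarrow> 'l::finite \<Rightarrow> complex"
  assumes "\<And>r p. (\<Sum>k\<in>UNIV. A r k * B k p) = (if p = r then 1 else 0)"
  shows "(\<Sum>k\<in>UNIV. fps_const (yangian_of_complex (A r k)) *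
            (\<Sum>p\<in>UNIV. fps_const (yangian_of_complex (B k p)) * f p)) = f r"
proof -
  have "(\<Sum>k\<in>UNIV. fps_const (yangian_of_complex (A r k)) *
            (\<Sum>p\<in>UNIV. fps_const (yangian_of_complex (B k p)) * f p))
      = (\<Sum>p\<in>UNIV. \<Sum>k\<in>UNIV. fps_const (yangian_of_complex (A r k * B k p)) * f p)"
    by (subst sum.swap)
       (simp add: sum_distrib_left yangian_of_complex_mult mult.assoc flip: fps_const_mult)
  also have "\<dots> = (\<Sum>p\<in>UNIV. fps_const (yangian_of_complex (\<Sum>k\<in>UNIV. A r k * B k p)) * f p)"
    by (simp add: yangian_of_complex_sum sum_distrib_right fps_const_sum')
  also have "\<dots> = (\<Sum>p\<in>UNIV. if p = r then f p else 0)"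
    by (intro sum.cong refl) (simp add: assms)
  finally show ?thesis by simp
qed

lemma root_pow_orthogonal:
  fixes r p :: "'n::finite mod_ring"
  shows "(\<Sum>k\<in>UNIV. root_pow (k * r) * (root_pow (- (k * p)) / of_nat CARD('n))) = (if p = r then 1 else 0)"
    and "(\<Sum>k\<in>UNIV. (root_pow (- (r * k)) / of_nat CARD('n)) * root_pow (p * k)) = (if p = r then 1 else 0)"
proof -
  have diff: "root_pow (k * x) * (root_pow (- (k * y)) / of_nat CARD('n)) = root_pow (k * (x - y)) / of_nat CARD('n)"
    for k x y :: "'n mod_ring"
    using root_pow_add[of "k * x" "- (k * y)"] by (simp add: right_diff_distrib)
  have *: "(\<Sum>k\<in>UNIV. root_pow (k * x) * (root_pow (- (k * y)) / of_nat CARD('n))) = (if y = x then 1 else 0)"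
    for x y :: "'n mod_ring"
    unfolding diff sum_divide_distrib[symmetric] sum_root_pow by simp
  show "(\<Sum>k\<in>UNIV. root_pow (k * r) * (root_pow (- (k * p)) / of_nat CARD('n))) = (if p = r then 1 else 0)"
    by (rule *)
  show "(\<Sum>k\<in>UNIV. (root_pow (- (r * k)) / of_nat CARD('n)) * root_pow (p * k)) = (if p = r then 1 else 0)"
    using *[of p r] by (simp add: mult.commute eq_commute)
qed

lemma principal_expansion_iff:
  "T_matrix = (\<Sum>k\<in>UNIV. \<Sum>l\<in>UNIV. series_tensor (S k l) (principal_basis k l)) \<longleftrightarrow>
     (\<forall>r l. T_series r (r + l) = (\<Sum>k\<in>UNIV. fps_const (yangian_of_complex (root_pow (k * r))) * S k l))"
  (is "T_matrix = ?E \<longleftrightarrow> ?R")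
proof -
  have "T_matrix = ?E \<longleftrightarrow> (\<forall>r s. T_matrix $ r $ s = ?E $ r $ s)"
    by (simp only: vec_eq_iff)
  also have "\<dots> \<longleftrightarrow> (\<forall>r l. T_matrix $ r $ (r + l) = ?E $ r $ (r + l))"
  proof (intro iffI allI)
    fix r s
    assume "\<forall>r l. T_matrix $ r $ (r + l) = ?E $ r $ (r + l)"
    then have "T_matrix $ r $ (r + (s - r)) = ?E $ r $ (r + (s - r))" by blast
    then show "T_matrix $ r $ s = ?E $ r $ s" by simp
  qed blast
  finally show ?thesis
    by (simp only: principal_expansion_nth T_matrix_nth)
qed

theorem principal_generators_exist_unique:
  "\<exists>!S :: 'n::finite mod_ring \<Rightarrow> 'n mod_ring \<Rightarrow> 'n yangian fps.
     T_matrix = (\<Sum>k\<in>UNIV. \<Sum>l\<in>UNIV. series_tensor (S k l) (principal_basis k l))"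
  unfolding principal_expansion_iff
proof (rule ex1I)
  let ?S = "\<lambda>k l. \<Sum>p\<in>UNIV. fps_const (yangian_of_complex (root_pow (- (k * p)) / of_nat CARD('n)))
                       * (T_series p (p + l) :: 'n yangian fps)"
  show "\<forall>r l. (T_series r (r + l) :: 'n yangian fps)
      = (\<Sum>k\<in>UNIV. fps_const (yangian_of_complex (root_pow (k * r))) * ?S k l)"
    by (intro allI inverse_transform[symmetric, where A = "\<lambda>r k. root_pow (k * r)"
          and B = "\<lambda>k p. root_pow (- (k * p)) / of_nat CARD('n)" and f = "\<lambda>p. T_series p (p + l)" for l]
          root_pow_orthogonal(1))
  fix S :: "'n mod_ring \<Rightarrow> 'n mod_ring \<Rightarrow> 'n yangian fps"
  assume S: "\<forall>r l. T_series r (r + l)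
      = (\<Sum>k\<in>UNIV. fps_const (yangian_of_complex (root_pow (k * r))) * S k l)"
  show "S = ?S"
  proof (intro ext)
    fix k l
    show "S k l = ?S k l"
      unfolding S[rule_format]
      by (rule inverse_transform[symmetric, where A = "\<lambda>k p. root_pow (- (k * p)) / of_nat CARD('n)"
            and B = "\<lambda>p k'. root_pow (k' * p)" and f = "\<lambda>k. S k l", OF root_pow_orthogonal(2)])
  qed
qed

section \<open>Two formal variables\<close>

text \<open>Both variables live in the iterated Laurent series ring \<open>Y((u\<^sup>-\<^sup>1))((v\<^sup>-\<^sup>1))\<close>: the coefficients are
  Laurent series in \<open>u\<^sup>-\<^sup>1\<close>, the outer variable is \<open>v\<^sup>-\<^sup>1\<close>. In this ring \<open>u - v\<close> is invertible and its
  inverse is the expansion \<open>- (\<Sum>r. u\<^sup>r v\<^sup>-\<^sup>r\<^sup>-\<^sup>1)\<close>.\<close>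

type_synonym 'n yangian_uv = "'n yangian fls fls"

definition uv_const :: "complex \<Rightarrow> 'n::finite yangian_uv" where
  "uv_const c = fls_const (fls_const (yangian_of_complex c))"

definition var_u :: "'n::finite yangian_uv" where
  "var_u = fls_const fls_X_inv"

definition var_v :: "'n::finite yangian_uv" where
  "var_v = fls_X_inv"

definition at_u :: "'n::finite yangian fps \<Rightarrow> 'n yangian_uv" where
  "at_u f = fls_const (fps_to_fls f)"

definition at_v :: "'n::finite yangian fps \<Rightarrow> 'n yangian_uv" where
  "at_v f = fps_to_fls (Abs_fps (\<lambda>m. fls_const (fps_nth f m)))"

text \<open>The class \<^class>\<open>inverse\<close> is not available here, as the Yangian is not a division ring.\<close>

definition ring_inverse :: "'a::ring_1 \<Rightarrow> 'a" where
  "ring_inverse x = (THE y. x * y = 1 \<and> y * x = 1)"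

lemma ring_inverse_eqI:
  assumes "x * y = 1" "y * x = 1"
  shows "ring_inverse x = y"
  unfolding ring_inverse_def
proof (rule the_equality)
  fix z assume "x * z = 1 \<and> z * x = 1"
  then show "z = y" using assms by (metis mult.assoc mult_1 mult_1_right)
qed (use assms in simp)

lemma
  defines "w \<equiv> fps_to_fls (Abs_fps (\<lambda>m. if m = 0 then 0 else - (fls_X_inv ^ (m - 1))))"
  shows ring_inverse_u_minus_v: "ring_inverse (var_u - var_v :: 'n::finite yangian_uv) = w"
    and u_minus_v_inverse: "(var_u - var_v :: 'n yangian_uv) * w = 1" "w * (var_u - var_v :: 'n yangian_uv) = 1"
proof -
  have w_nth: "fls_nth w m = (if m \<le> 0 then 0 else - (fls_X_inv ^ nat (m - 1)))" for m
    by (auto simp: w_def nat_diff_distrib)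
  have pow: "fls_shift 1 (fls_X_inv ^ nat (m - 1)) = (fls_X_inv ^ nat m :: 'n yangian fls)"
    if "m > 0" for m
    using that by (simp flip: power_Suc fls_X_inv_times_conv_shift(1) add: Suc_nat_eq_nat_zadd1)
  show 1: "(var_u - var_v :: 'n yangian_uv) * w = 1"
    by (rule fls_eqI) (auto simp: var_u_def var_v_def left_diff_distrib w_nth fls_X_inv_times_conv_shift pow)
  show 2: "w * (var_u - var_v :: 'n yangian_uv) = 1"
    by (rule fls_eqI) (auto simp: var_u_def var_v_def right_diff_distrib w_nth fls_X_inv_times_conv_shift pow)
  show "ring_inverse (var_u - var_v :: 'n yangian_uv) = w"
    using 1 2 by (rule ring_inverse_eqI)
qed

end

theory Submission
  imports Defs
begin

text \<open>For fixed \<open>l\<close>, the series \<open>S\<^sub>k\<^sub>l\<close> are the discrete Fourier transform in \<open>p\<close> of the series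
  \<open>T\<^sub>p\<^sub>,\<^sub>p\<^sub>+\<^sub>l\<close>. Transforming the relation for \<open>(u - v) [T\<^sub>i\<^sub>j(u), T\<^sub>k\<^sub>l(v)]\<close> in both factors gives the same
  coefficient \<open>\<omega>\<^sup>j\<^sup>a\<^sup>-\<^sup>a\<^sup>l\<^sup>-\<^sup>a\<^sup>b / n\<close> in both sums; the substitution \<open>a \<mapsto> i - k - a\<close>, \<open>b \<mapsto> j - l - b\<close>
  brings the first sum into its final form.\<close>

lemma yangian_of_complex_commute: "yangian_of_complex c * y = y * yangian_of_complex c"
proof transfer
  fix c and x :: "'a yangian_symbol free_algebra"
  have "Poly_Mapping.single 0 c * x = x * Poly_Mapping.single 0 c"
  proof (induction x rule: update_induct)
    case (update f a b)
    have "Poly_Mapping.update a b f = f + Poly_Mapping.single a b"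
      using update by (intro poly_mapping_eqI)
        (auto simp: lookup_update lookup_add lookup_single when_def in_keys_iff)
    then show ?case
      using update by (simp add: ring_distribs mult_single mult.commute)
  qed simp
  then show "yangian_rel (Poly_Mapping.single 0 c * x) (x * Poly_Mapping.single 0 c)"
    by (simp add: yangian_rel_refl)
qed

lemma uv_const_commute: "uv_const c * x = x * uv_const c"
  by (intro fls_eqI) (simp add: uv_const_def yangian_of_complex_commute)

lemma uv_const_mult: "uv_const (c * d) = uv_const c * uv_const d"
  by (simp add: uv_const_def yangian_of_complex_mult fls_const_mult_const)

lemma uv_const_0 [simp]: "uv_const 0 = 0"
  by (simp add: uv_const_def)

lemma uv_const_add: "uv_const (c + d) = uv_const c + uv_const d"
  by (simp add: uv_const_def yangian_of_complex_add fls_plus_const)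

lemma uv_const_sum: "uv_const (sum f A) = (\<Sum>x\<in>A. uv_const (f x))"
  by (induction A rule: infinite_finite_induct) (simp_all add: uv_const_add)

lemma uv_const_scale_mult: "(uv_const c * x) * (uv_const d * y) = uv_const (c * d) * (x * y)"
  by (metis mult.assoc uv_const_commute uv_const_mult)

lemma uv_const_scale_left_commute: "z * (uv_const c * x) = uv_const c * (z * x)"
  by (metis mult.assoc uv_const_commute)

lemma at_u_linear:
  "at_u (\<Sum>p\<in>A. fps_const (yangian_of_complex (c p)) * f p) = (\<Sum>p\<in>A. uv_const (c p) * at_u (f p))"
proof -
  have "at_u (f + g) = at_u f + at_u g" for f g :: "'a yangian fps"
    by (simp add: at_u_def fls_plus_const)
  moreover have "at_u (fps_const (yangian_of_complex d) * f) = uv_const d * at_u f"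
    for d and f :: "'a yangian fps"
    by (simp add: at_u_def uv_const_def fls_times_fps_to_fls fls_const_mult_const)
  ultimately show ?thesis
    by (induction A rule: infinite_finite_induct) (simp_all add: at_u_def)
qed

lemma at_v_linear:
  "at_v (\<Sum>p\<in>A. fps_const (yangian_of_complex (c p)) * f p) = (\<Sum>p\<in>A. uv_const (c p) * at_v (f p))"
proof -
  have "at_v (f + g) = at_v f + at_v g" for f g :: "'a yangian fps"
    by (intro fls_eqI) (simp add: at_v_def fls_plus_const)
  moreover have "at_v (fps_const (yangian_of_complex d) * f) = uv_const d * at_v f"
    for d and f :: "'a yangian fps"
    by (intro fls_eqI) (simp add: at_v_def uv_const_def fls_const_mult_const)
  moreover have "at_v (0 :: 'a yangian fps) = 0"
    by (intro fls_eqI) (simp add: at_v_def)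
  ultimately show ?thesis
    by (induction A rule: infinite_finite_induct) simp_all
qed

lemma at_u_mult_at_v_nth:
  "fls_nth (fls_nth (at_u f * at_v g) n) m
     = (if m < 0 \<or> n < 0 then 0 else fps_nth f (nat m) * fps_nth g (nat n))"
  by (simp add: at_u_def at_v_def)

lemma at_v_mult_at_u_nth:
  "fls_nth (fls_nth (at_v g * at_u f) n) m
     = (if m < 0 \<or> n < 0 then 0 else fps_nth g (nat n) * fps_nth f (nat m))"
  by (simp add: at_u_def at_v_def)

lemma u_minus_v_mult_nth:
  "fls_nth (fls_nth ((var_u - var_v) * z) n) m
     = fls_nth (fls_nth z n) (m + 1) - fls_nth (fls_nth z (n + 1)) m"
  by (simp add: var_u_def var_v_def left_diff_distrib fls_X_inv_times_conv_shift)

lemma T_series_relation: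
  "(var_u - var_v) * commutator (at_u (T_series i j)) (at_v (T_series i' j'))
     = at_u (T_series i' j) * at_v (T_series i j') - at_v (T_series i' j) * at_u (T_series i j')"
proof (intro fls_eqI)
  fix n m :: int
  consider "m < -1" | "n < -1" | "m = -1" "n \<ge> -1" | "n = -1" "m \<ge> -1" | "m \<ge> 0" "n \<ge> 0"
    by linarith
  then show "fls_nth (fls_nth ((var_u - var_v) * commutator (at_u (T_series i j)) (at_v (T_series i' j'))) n) m
     = fls_nth (fls_nth (at_u (T_series i' j) * at_v (T_series i j') - at_v (T_series i' j) * at_u (T_series i j')) n) m"
  proof cases
    case 5
    then have "nat (m + 1) = nat m + 1" "nat (n + 1) = nat n + 1" by simp_all
    then show ?thesis
      using 5 yangian_T_relation[of i j "nat m" i' j' "nat n"]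
      by (simp add: u_minus_v_mult_nth at_u_mult_at_v_nth at_v_mult_at_u_nth commutator_def T_series_def)
  qed (auto simp: u_minus_v_mult_nth at_u_mult_at_v_nth at_v_mult_at_u_nth commutator_def
        T_series_def yangian_T_0)
qed

lemma S_series_eq:
  "S_series k l = (\<Sum>p\<in>UNIV. fps_const (yangian_of_complex (root_pow (- (k * p)) / of_nat CARD('n)))
      * (T_series p (p + l) :: 'n::finite yangian fps))"
proof -
  have "T_matrix = (\<Sum>k\<in>UNIV. \<Sum>l\<in>UNIV. series_tensor (S_series k l) (principal_basis k l)
      :: 'n yangian fps^'n mod_ring^'n mod_ring)"
    unfolding S_series_def by (rule theI'[OF principal_generators_exist_unique])
  then have S: "T_series r (r + l)
      = (\<Sum>k\<in>UNIV. fps_const (yangian_of_complex (root_pow (k * r))) * (S_series k l :: 'n yangian fps))"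
    for r l
    unfolding principal_expansion_iff by blast
  show ?thesis
    unfolding S
    by (rule inverse_transform[symmetric, where A = "\<lambda>k p. root_pow (- (k * p)) / of_nat CARD('n)"
          and B = "\<lambda>p k'. root_pow (k' * p)" and f = "\<lambda>k. S_series k l", OF root_pow_orthogonal(2)])
qed

definition fourier ::
    "('n::finite mod_ring \<Rightarrow> 'n mod_ring \<Rightarrow> 'n yangian_uv) \<Rightarrow> 'n mod_ring \<Rightarrow> 'n mod_ring \<Rightarrow> 'n yangian_uv" where
  "fourier X k l = (\<Sum>p\<in>UNIV. uv_const (root_pow (- (k * p)) / of_nat CARD('n)) * X p (p + l))"

lemma at_u_S_series: "at_u (S_series k l) = fourier (\<lambda>r s. at_u (T_series r s)) k l"
  by (simp add: S_series_eq at_u_linear fourier_def)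

lemma at_v_S_series: "at_v (S_series k l) = fourier (\<lambda>r s. at_v (T_series r s)) k l"
  by (simp add: S_series_eq at_v_linear fourier_def)

lemma fourier_mult:
  fixes X Y :: "'n::finite mod_ring \<Rightarrow> 'n mod_ring \<Rightarrow> 'n yangian_uv"
  shows "fourier X k l * fourier Y i j
    = (\<Sum>r\<in>UNIV. \<Sum>s\<in>UNIV. uv_const (root_pow (- (k * r) - i * s) / (of_nat CARD('n))\<^sup>2) *
         (X r (r + l) * Y s (s + j)))"
proof -
  have "root_pow (- (k * r)) / of_nat CARD('n) * (root_pow (- (i * s)) / of_nat CARD('n))
      = root_pow (- (k * r) - i * s) / (of_nat CARD('n))\<^sup>2" for r s
    using root_pow_add[of "- (k * r)" "- (i * s)"] by (simp add: power2_eq_square)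
  then show ?thesis
    by (simp only: fourier_def sum_product uv_const_scale_mult)
qed

text \<open>The sum over \<open>a\<close> is a character sum that forces \<open>b = j - l - r + s\<close>, which exchanges the column
  indices of the two factors.\<close>

lemma fourier_exchange:
  fixes X Y :: "'n::finite mod_ring \<Rightarrow> 'n mod_ring \<Rightarrow> 'n yangian_uv"
  shows "(\<Sum>a\<in>UNIV. \<Sum>b\<in>UNIV. uv_const (root_pow (j * a - a * l - a * b) / of_nat CARD('n)) *
            fourier X (k + a) (l + b) * fourier Y (i - a) (j - b))
    = (\<Sum>r\<in>UNIV. \<Sum>s\<in>UNIV. uv_const (root_pow (- (k * r) - i * s) / (of_nat CARD('n))\<^sup>2) *
         (X r (s + j) * Y s (r + l)))" (is "?L = ?R")
proof -
  let ?n = "of_nat CARD('n) :: complex"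
  let ?Z = "\<lambda>b r s. X r (r + (l + b)) * Y s (s + (j - b))"
  have coeff: "root_pow (j * a - a * l - a * b) / ?n * (root_pow (- ((k + a) * r) - (i - a) * s) / ?n\<^sup>2)
      = root_pow (- (k * r) - i * s) / ?n ^ 3 * root_pow (a * (j - l - b - r + s))" for a b r s
  proof -
    have "(j * a - a * l - a * b) + (- ((k + a) * r) - (i - a) * s)
        = (- (k * r) - i * s) + a * (j - l - b - r + s)"
      by (simp add: algebra_simps)
    then show ?thesis
      by (simp add: power2_eq_square power3_eq_cube flip: root_pow_add)
  qed
  have "?L = (\<Sum>a\<in>UNIV. \<Sum>b\<in>UNIV. \<Sum>r\<in>UNIV. \<Sum>s\<in>UNIV.
      uv_const (root_pow (- (k * r) - i * s) / ?n ^ 3 * root_pow (a * (j - l - b - r + s))) * ?Z b r s)"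
    by (simp only: mult.assoc fourier_mult sum_distrib_left coeff flip: uv_const_mult)
       (simp only: coeff flip: mult.assoc uv_const_mult)
  also have "\<dots> = (\<Sum>r\<in>UNIV. \<Sum>s\<in>UNIV. \<Sum>b\<in>UNIV. \<Sum>a\<in>UNIV.
      uv_const (root_pow (- (k * r) - i * s) / ?n ^ 3 * root_pow (a * (j - l - b - r + s))) * ?Z b r s)"
    (is "(\<Sum>a\<in>_. \<Sum>b\<in>_. \<Sum>r\<in>_. \<Sum>s\<in>_. ?f a b r s) = _")
  proof -
    have "(\<Sum>a\<in>UNIV. \<Sum>b\<in>UNIV. \<Sum>r\<in>UNIV. \<Sum>s\<in>UNIV. ?f a b r s)
        = (\<Sum>(a, b, r, s)\<in>UNIV. ?f a b r s)"
      by (simp add: sum.cartesian_product split_def flip: UNIV_Times_UNIV)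
    also have "\<dots> = (\<Sum>(r, s, b, a)\<in>UNIV. ?f a b r s)"
      by (rule sum.reindex_bij_witness[of _ "\<lambda>(r, s, b, a). (a, b, r, s)" "\<lambda>(a, b, r, s). (r, s, b, a)"]) auto
    also have "\<dots> = (\<Sum>r\<in>UNIV. \<Sum>s\<in>UNIV. \<Sum>b\<in>UNIV. \<Sum>a\<in>UNIV. ?f a b r s)"
      by (simp add: sum.cartesian_product split_def flip: UNIV_Times_UNIV)
    finally show ?thesis .
  qed
  also have "\<dots> = ?R"
  proof (intro sum.cong refl)
    fix r s
    let ?c = "root_pow (- (k * r) - i * s)"
    have "(\<Sum>a\<in>UNIV. uv_const (?c / ?n ^ 3 * root_pow (a * (j - l - b - r + s))) * ?Z b r s)
        = (if b = j - l - r + s then uv_const (?c / ?n\<^sup>2) * ?Z b r s else 0)" for b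
    proof -
      have "(\<Sum>a\<in>UNIV. uv_const (?c / ?n ^ 3 * root_pow (a * (j - l - b - r + s))) * ?Z b r s)
          = uv_const (?c / ?n ^ 3 * (\<Sum>a\<in>UNIV. root_pow (a * (j - l - b - r + s)))) * ?Z b r s"
        by (simp only: sum_distrib_right sum_distrib_left uv_const_sum)
      moreover have "j - l - b - r + s = 0 \<longleftrightarrow> b = j - l - r + s"
        by (auto simp: algebra_simps)
      ultimately show ?thesis
        unfolding sum_root_pow by (simp add: power2_eq_square power3_eq_cube)
    qed
    then have "(\<Sum>b\<in>UNIV. \<Sum>a\<in>UNIV. uv_const (?c / ?n ^ 3 * root_pow (a * (j - l - b - r + s))) * ?Z b r s)
        = uv_const (?c / ?n\<^sup>2) * ?Z (j - l - r + s) r s"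
      by simp
    moreover have "r + (l + (j - l - r + s)) = s + j" "s + (j - (j - l - r + s)) = r + l"
      by (simp_all add: algebra_simps)
    ultimately show "(\<Sum>b\<in>UNIV. \<Sum>a\<in>UNIV. uv_const (?c / ?n ^ 3 * root_pow (a * (j - l - b - r + s))) * ?Z b r s)
        = uv_const (?c / ?n\<^sup>2) * (X r (s + j) * Y s (r + l))"
      by (simp only:)
  qed
  finally show ?thesis .
qed

lemma S_series_relation:
  fixes i j k l :: "'n::finite mod_ring"
  shows "(var_u - var_v) * commutator (at_u (S_series i j)) (at_v (S_series k l)) =
     (\<Sum>a\<in>UNIV. \<Sum>b\<in>UNIV. uv_const (root_pow (j * a - a * l - a * b) / of_nat CARD('n)) *
        at_u (S_series (k + a) (l + b)) * at_v (S_series (i - a) (j - b)))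
   - (\<Sum>a\<in>UNIV. \<Sum>b\<in>UNIV. uv_const (root_pow (j * a - a * l - a * b) / of_nat CARD('n)) *
        at_v (S_series (k + a) (l + b)) * at_u (S_series (i - a) (j - b)))"
proof -
  let ?c = "\<lambda>r s. uv_const (root_pow (- (k * r) - i * s) / (of_nat CARD('n))\<^sup>2) :: 'n yangian_uv"
  have uv: "at_u (S_series i j) * at_v (S_series k l)
      = (\<Sum>r\<in>UNIV. \<Sum>s\<in>UNIV. ?c r s * (at_u (T_series s (s + j)) * at_v (T_series r (r + l))))"
    unfolding at_u_S_series at_v_S_series fourier_mult
    by (subst sum.swap) (simp only: minus_diff_commute[of "k * r" "i * s" for r s])
  have vu: "at_v (S_series k l) * at_u (S_series i j)
      = (\<Sum>r\<in>UNIV. \<Sum>s\<in>UNIV. ?c r s * (at_v (T_series r (r + l)) * at_u (T_series s (s + j))))"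
    unfolding at_u_S_series at_v_S_series fourier_mult by simp
  have "commutator (at_u (S_series i j)) (at_v (S_series k l))
      = (\<Sum>r\<in>UNIV. \<Sum>s\<in>UNIV. ?c r s * commutator (at_u (T_series s (s + j))) (at_v (T_series r (r + l))))"
    by (simp only: commutator_def uv vu right_diff_distrib sum_subtractf)
  then have "(var_u - var_v) * commutator (at_u (S_series i j)) (at_v (S_series k l))
      = (\<Sum>r\<in>UNIV. \<Sum>s\<in>UNIV. ?c r s *
           (at_u (T_series r (s + j)) * at_v (T_series s (r + l)) - at_v (T_series r (s + j)) * at_u (T_series s (r + l))))"
    by (simp only: sum_distrib_left uv_const_scale_left_commute T_series_relation)
  then show ?thesis
    unfolding at_u_S_series at_v_S_series fourier_exchange
    by (simp only: right_diff_distrib sum_subtractf)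
qed

theorem theorem3p4:
  fixes i j k l :: "'n::finite mod_ring"
  shows "commutator (at_u (S_series i j)) (at_v (S_series k l)) =
    ring_inverse (var_u - var_v) *
      ((\<Sum>a\<in>UNIV. \<Sum>b\<in>UNIV. uv_const (root_pow (i * b - b * k - a * b) / of_nat CARD('n)) *
           at_u (S_series (i - a) (j - b)) * at_v (S_series (k + a) (l + b)))
     - (\<Sum>a\<in>UNIV. \<Sum>b\<in>UNIV. uv_const (root_pow (j * a - a * l - a * b) / of_nat CARD('n)) *
           at_v (S_series (k + a) (l + b)) * at_u (S_series (i - a) (j - b))))"
    (is "?C = _ * (?U - ?V)")
proof -
  have "?U = (\<Sum>a\<in>UNIV. \<Sum>b\<in>UNIV. uv_const (root_pow (j * a - a * l - a * b) / of_nat CARD('n)) *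
        at_u (S_series (k + a) (l + b)) * at_v (S_series (i - a) (j - b)))" (is "_ = ?W")
  proof -
    have reflect: "(\<Sum>a\<in>UNIV. f a) = (\<Sum>a\<in>UNIV. f (c - a))" for f :: "'n mod_ring \<Rightarrow> 'n yangian_uv" and c
      by (rule sum.reindex_bij_witness[of _ "\<lambda>a. c - a" "\<lambda>a. c - a"]) simp_all
    have "?U = (\<Sum>a\<in>UNIV. \<Sum>b\<in>UNIV.
        uv_const (root_pow (i * (j - l - b) - (j - l - b) * k - (i - k - a) * (j - l - b)) / of_nat CARD('n)) *
        at_u (S_series (i - (i - k - a)) (j - (j - l - b))) * at_v (S_series (k + (i - k - a)) (l + (j - l - b))))"
      by (subst reflect[where c = "i - k"], subst reflect[where c = "j - l"]) (rule refl)
    also have "\<dots> = ?W"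
      by (simp add: algebra_simps)
    finally show ?thesis .
  qed
  then have eq: "(var_u - var_v) * ?C = ?U - ?V"
    using S_series_relation[of i j k l] by simp
  have "ring_inverse (var_u - var_v) * (var_u - var_v) = (1 :: 'n yangian_uv)"
    unfolding ring_inverse_u_minus_v by (rule u_minus_v_inverse)
  then have "?C = ring_inverse (var_u - var_v) * ((var_u - var_v) * ?C)"
    by (simp flip: mult.assoc)
  then show ?thesis
    unfolding eq .
qed

end
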